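(* There are absolute constants $c,C>0$ such that, for every sufficiently large integer $n$, there exists a $1$-degenerate ordered $3$-graph $F$ on at most $2^{Cn}$ vertices such that \[ r_<\bigl(F,K_3^{(3)}(n)\bigr)>2^{c n^2}. \]
   Context: An ordered $k$-graph is a (finite) $k$-uniform hypergraph equipped with a linear order on its vertex set. An ordered $k$-graph $G$ contains an ordered copy of an ordered $k$-graph $H$ if there is an order-preserving injection $\phi\colon V(H)\to V(G)$ such that $\phi(e)\in E(G)$ for every $e\in E(H)$. For ordered $k$-graphs $G$ and $H$, the ordered Ramsey number $r_<(G,H)$ is the smallest integer $N$ such that every red-blue coloring of the edges of the naturally ordered complete $k$-graph on $[N]=\{1,\dots,N\}$ contains a blue ordered copy of $G$ or a red ordered copy of $H$. $K_3^{(3)}(n)$ denotes the ordered complete tripartite $3$-graph on $3n$ vertices whose three vertex classes are consecutive intervals of size $n$, arranged from left to right; its edges are all triples with exactly one vertex in each class. An ordered $3$-graph $H$ on $t$ vertices is $d$-degenerate (standard degeneracy) if its vertices admit an ordering $u_1,\ldots,u_t$ (not necessarily related to the given linear order on $V(H)$) such that, for every $i$, \[ \bigl|\{e\in E(H): u_i\in e \text{ and } e\setminus\{u_i\}\subseteq\{u_1,\ldots,u_{i-1}\}\}\bigr|\le d. \] *)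

theory Defs
  imports Complex_Main "HOL-Library.Ramsey"
begin

datatype 'a hypergraph = Hypergraph (verts: "'a set") (edges: "'a set set")

text \<open>The linear order on the vertex set is the one inherited from the vertex type.\<close>

definition ordered_kgraph :: "nat \<Rightarrow> 'a::linorder hypergraph \<Rightarrow> bool" where
  "ordered_kgraph k G \<longleftrightarrow> finite (verts G) \<and> edges G \<subseteq> nsets (verts G) k"

definition contains_ordered_copy ::
  "'a::linorder hypergraph \<Rightarrow> 'b::linorder hypergraph \<Rightarrow> bool" where
  "contains_ordered_copy G H \<longleftrightarrow>
     (\<exists>\<phi>. strict_mono_on (verts H) \<phi> \<and> \<phi> ` verts H \<subseteq> verts G \<and>
          (\<forall>e\<in>edges H. \<phi> ` e \<in> edges G))"

datatype color = Red | Blue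

definition color_class :: "nat \<Rightarrow> nat \<Rightarrow> (nat set \<Rightarrow> color) \<Rightarrow> color \<Rightarrow> nat hypergraph" where
  "color_class k N \<chi> col = Hypergraph {1..N} {e \<in> nsets {1..N} k. \<chi> e = col}"

definition ordered_arrows ::
  "nat \<Rightarrow> nat \<Rightarrow> 'a::linorder hypergraph \<Rightarrow> 'b::linorder hypergraph \<Rightarrow> bool" where
  "ordered_arrows k N G H \<longleftrightarrow>
     (\<forall>\<chi>. contains_ordered_copy (color_class k N \<chi> Blue) G \<or>
          contains_ordered_copy (color_class k N \<chi> Red) H)"

text \<open>For \<open>k\<close>-graphs \<open>G\<close> and \<open>H\<close> the minimum is over a nonempty set;
  see \<open>ordered_arrows_exists\<close> below.\<close>

definition ordered_ramsey ::
  "nat \<Rightarrow> 'a::linorder hypergraph \<Rightarrow> 'b::linorder hypergraph \<Rightarrow> nat" where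
  "ordered_ramsey k G H = (LEAST N. ordered_arrows k N G H)"

definition complete_tripartite3 :: "nat \<Rightarrow> nat hypergraph" where
  "complete_tripartite3 n =
     Hypergraph {1..3*n}
       {{x, y, z} | x y z. x \<in> {1..n} \<and> y \<in> {n+1..2*n} \<and> z \<in> {2*n+1..3*n}}"

definition degenerate :: "nat \<Rightarrow> 'a hypergraph \<Rightarrow> bool" where
  "degenerate d H \<longleftrightarrow>
     (\<exists>us. distinct us \<and> set us = verts H \<and>
           (\<forall>i<length us.
              card {e \<in> edges H. us ! i \<in> e \<and> e - {us ! i} \<subseteq> set (take i us)} \<le> d))"

lemma finite_order_embedding:
  fixes A :: "'a::linorder set" and B :: "'b::linorder set"
  assumes "finite A" "finite B" "card A = card B"
  shows "\<exists>\<phi>. strict_mono_on A \<phi> \<and> \<phi> ` A \<subseteq> B"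
proof -
  define r where "r x = card {y \<in> A. y < x}" for x
  define \<phi> where "\<phi> x = sorted_list_of_set B ! r x" for x
  have lt: "r x < card B" if "x \<in> A" for x
    unfolding r_def assms(3)[symmetric] using that assms(1)
    by (intro psubset_card_mono) auto
  have mono: "r x < r y" if "x \<in> A" "x < y" for x y
    unfolding r_def using that assms(1) by (intro psubset_card_mono) auto
  have "strict_mono_on A \<phi>"
    unfolding strict_mono_on_def \<phi>_def
    using lt mono by (auto intro!: sorted_wrt_nth_less[OF strict_sorted_list_of_set])
  moreover have "\<phi> x \<in> B" if "x \<in> A" for x
    using nth_mem[of "r x" "sorted_list_of_set B"] lt[OF that] assms(2) by (simp add: \<phi>_def)
  ultimately show ?thesis by blast
qed

lemma contains_ordered_copy_clique:
  fixes G :: "'a::linorder hypergraph"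
  assumes G: "ordered_kgraph k G" and X: "X \<in> nsets {1..N} (card (verts G))"
    and mono: "\<And>e. e \<in> nsets X k \<Longrightarrow> \<chi> e = col"
  shows "contains_ordered_copy (color_class k N \<chi> col) G"
proof -
  from G X have fin: "finite (verts G)" "finite X" "card (verts G) = card X" "X \<subseteq> {1..N}"
    by (auto simp: ordered_kgraph_def nsets_def)
  from finite_order_embedding[OF fin(1-3)] obtain \<phi> where
    \<phi>: "strict_mono_on (verts G) \<phi>" "\<phi> ` verts G \<subseteq> X" by blast
  have "\<phi> ` e \<in> edges (color_class k N \<chi> col)" if "e \<in> edges G" for e
  proof -
    have e: "e \<subseteq> verts G" "finite e" "card e = k"
      using that G by (auto simp: ordered_kgraph_def nsets_def)
    have "inj_on \<phi> e"
      using strict_mono_on_imp_inj_on[OF \<phi>(1)] e(1) by (rule inj_on_subset)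
    then have *: "\<phi> ` e \<in> nsets X k"
      using e \<phi>(2) by (auto simp: nsets_def card_image)
    moreover have "\<phi> ` e \<in> nsets {1..N} k"
      using * fin(4) by (auto simp: nsets_def)
    ultimately show ?thesis using mono by (auto simp: color_class_def)
  qed
  then show ?thesis
    unfolding contains_ordered_copy_def using \<phi> fin(4) by (auto simp: color_class_def)
qed

lemma ordered_arrows_exists:
  assumes G: "ordered_kgraph k G" and H: "ordered_kgraph k H"
  shows "\<exists>N. ordered_arrows k N G H"
proof -
  obtain N :: nat where N: "partn_lst {..<N} [card (verts G), card (verts H)] k"
    using ramsey_full by blast
  have "ordered_arrows k N G H"
    unfolding ordered_arrows_def
  proof
    fix \<chi>
    define f where "f e = (if \<chi> (Suc ` e) = Blue then 0 else 1::nat)" for e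
    have "f \<in> nsets {..<N} k \<rightarrow> {..<2}" by (auto simp: f_def)
    then have "f \<in> nsets {..<N} k \<rightarrow> {..<length [card (verts G), card (verts H)]}"
      by (simp add: numeral_2_eq_2)
    with N obtain i X where i: "i < 2"
      and X: "X \<in> nsets {..<N} ([card (verts G), card (verts H)] ! i)"
      and fX: "f ` nsets X k \<subseteq> {i}"
      unfolding partn_lst_def monochromatic_def by (auto simp: numeral_2_eq_2)
    have X': "Suc ` X \<in> nsets {1..N} ([card (verts G), card (verts H)] ! i)"
      using X by (auto simp: nsets_def card_image)
    have col: "\<chi> e = (if i = 0 then Blue else Red)" if eX: "e \<in> nsets (Suc ` X) k" for e
    proof -
      obtain e' where e': "e = Suc ` e'" "e' \<subseteq> X"
        using eX unfolding nsets_def subset_image_iff by blast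
      then have "e' \<in> nsets X k"
        using eX by (auto simp: nsets_def card_image finite_image_iff)
      then have "f e' = i" using fX by blast
      then show ?thesis
        using i e'(1) by (cases "\<chi> e") (auto simp: f_def)
    qed
    consider "i = 0" | "i = 1" using i by linarith
    then show "contains_ordered_copy (color_class k N \<chi> Blue) G \<or>
               contains_ordered_copy (color_class k N \<chi> Red) H"
    proof cases
      case 1
      then show ?thesis using contains_ordered_copy_clique[OF G] X' col by simp
    next
      case 2
      then show ?thesis using contains_ordered_copy_clique[OF H] X' col by simp
    qed
  qed
  then show ?thesis ..
qed

end

theory Submission
  imports Defs
begin

text \<open>Choose a random graph \<open>G\<close> of density \<open>2^-n\<close> on \<open>[M]\<close> with \<open>M \<le> 2^(n^2/16)\<close>, and colour a
  triple \<open>x < y < z\<close> red if \<open>{x, y}\<close> is an edge of \<open>G\<close>, and uniformly at random otherwise. Every set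
  of \<open>m = 2^(2n)\<close> vertices spans an edge of \<open>G\<close>. Hence there is no blue copy of the 1-degenerate
  \<open>F\<close> consisting of \<open>m\<close> base vertices and, for each pair of these, one edge joining the pair to a
  private vertex further right. On the other hand \<open>G\<close> is so sparse that at least half of the
  pairs between any two \<open>n\<close>-sets are not edges of \<open>G\<close>, so a red tripartite graph would require
  \<open>n^3/2\<close> independent random triples to be red.\<close>

section \<open>Union bound in counting form\<close>

text \<open>For a uniformly random function from \<open>E\<close> to \<open>{..<q}\<close>, the
  summand for \<open>i\<close> is the probability that all of \<open>A i\<close> is mapped into
  \<open>B i\<close>. If these sum to less than 1, some function avoids every such event. This
  serves twice: to choose the graph and to colour the triples.\<close>

lemma exists_function_avoiding:
  fixes I :: "'i set" and A :: "'i \<Rightarrow> 'a set" and B :: "'i \<Rightarrow> nat set" and q :: nat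
  assumes "finite E" "finite I" "q > 0"
    and A: "\<And>i. i \<in> I \<Longrightarrow> A i \<subseteq> E" and B: "\<And>i. i \<in> I \<Longrightarrow> B i \<subseteq> {..<q}"
    and sum: "(\<Sum>i\<in>I. (real (card (B i)) / real q) ^ card (A i)) < 1"
  obtains f where "f \<in> E \<rightarrow> {..<q}" "\<And>i. i \<in> I \<Longrightarrow> \<exists>a\<in>A i. f a \<notin> B i"
proof -
  define \<Omega> where "\<Omega> = (\<Pi>\<^sub>E a\<in>E. {..<q})"
  define bad where "bad i = (\<Pi>\<^sub>E a\<in>E. if a \<in> A i then B i else {..<q})" for i
  have fin: "finite \<Omega>" and card\<Omega>: "card \<Omega> = q ^ card E"
    using assms by (auto simp: \<Omega>_def card_PiE intro!: finite_PiE)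
  have sub: "bad i \<subseteq> \<Omega>" if "i \<in> I" for i
    unfolding bad_def \<Omega>_def using B[OF that] by (intro PiE_mono) auto
  have card_bad: "real (card (bad i)) = real (card \<Omega>) * (real (card (B i)) / real q) ^ card (A i)"
    if "i \<in> I" for i
  proof -
    \<comment> \<open>Each coordinate in \<open>A i\<close> has \<open>card (B i)\<close> choices,
      each other coordinate has \<open>q\<close>.\<close>
    have "card (bad i) = (\<Prod>a\<in>E. if a \<in> A i then card (B i) else q)"
      unfolding bad_def using \<open>finite E\<close> by (subst card_PiE) (auto intro!: prod.cong)
    also have "\<dots> = card (B i) ^ card (A i) * q ^ card (E - A i)"
    proof -
      have "E \<inter> {a. a \<in> A i} = A i" "E \<inter> - {a. a \<in> A i} = E - A i"
        using A[OF that] by auto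
      then show ?thesis using \<open>finite E\<close> by (subst prod.If_cases) auto
    qed
    finally have *: "card (bad i) = card (B i) ^ card (A i) * q ^ card (E - A i)" .
    have "card E = card (A i) + card (E - A i)"
      using A[OF that] \<open>finite E\<close> by (simp add: card_Diff_subset card_mono finite_subset)
    then show ?thesis
      using \<open>q > 0\<close> by (simp add: * card\<Omega> power_add power_divide)
  qed
  have "real (card (\<Union>i\<in>I. bad i)) \<le> (\<Sum>i\<in>I. real (card (bad i)))"
    using card_UN_le[OF \<open>finite I\<close>, of bad] by (metis of_nat_le_iff of_nat_sum)
  also have "\<dots> = real (card \<Omega>) * (\<Sum>i\<in>I. (real (card (B i)) / real q) ^ card (A i))"
    by (simp add: card_bad sum_distrib_left)
  also have "\<dots> < real (card \<Omega>)"
    using sum \<open>q > 0\<close> by (simp add: card\<Omega>)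
  finally have "card (\<Union>i\<in>I. bad i) < card \<Omega>" by simp
  then have "\<not> \<Omega> \<subseteq> (\<Union>i\<in>I. bad i)"
    using sub fin by (meson UN_least card_mono finite_subset not_le)
  then obtain f where f: "f \<in> \<Omega>" "\<And>i. i \<in> I \<Longrightarrow> f \<notin> bad i" by blast
  have "\<exists>a\<in>A i. f a \<notin> B i" if "i \<in> I" for i
    using f(1) f(2)[OF that] by (auto simp: bad_def \<Omega>_def PiE_iff split: if_splits)
  then show thesis
    using f(1) by (intro that[of f]) (auto simp: \<Omega>_def)
qed

section \<open>A sparse random graph meeting every large set\<close>

lemma card_nsets_le_power:
  assumes "finite V"
  shows "card (nsets V k) \<le> card V ^ k"
proof (cases "k \<le> card V")
  case True
  then show ?thesis by (simp add: card_nsets binomial_le_pow)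
next
  case False
  then show ?thesis by (simp add: card_nsets binomial_eq_0)
qed

text \<open>\<open>G\<close> is the zero set of a random function into \<open>{..<q}\<close>, so
  each pair is an edge with probability \<open>1 / q\<close>. The left sides of \<open>dense\<close>
  and \<open>sparse\<close> bound the probabilities that some \<open>m\<close>-set spans no edge and
  that some \<open>r\<close>-set spans at least \<open>s\<close> edges.\<close>

lemma sparse_graph_hitting_large_sets:
  fixes V :: "'a set" and q m r s :: nat
  assumes "finite V" "q > 0"
    and dense: "real (card V) ^ m * (1 - 1 / real q) ^ (m choose 2) < 1 / 2"
    and sparse: "real (card V) ^ r * 2 ^ (r choose 2) * (1 / real q) ^ s < 1 / 2"
  obtains G where "\<And>U. U \<in> nsets V m \<Longrightarrow> \<exists>P\<in>nsets U 2. P \<in> G"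
    and "\<And>W. W \<in> nsets V r \<Longrightarrow> card (nsets W 2 \<inter> G) < s"
proof -
  \<comment> \<open>An index is the event itself, a pair of a set of pairs and its forbidden values:
    \<open>{1..<q}\<close> says that all pairs in \<open>U\<close> are non-edges, \<open>{0}\<close>
    that all pairs in \<open>S\<close> are edges. Taking images may merge equal events, which only
    lowers the sum of weights.\<close>
  define I1 where "I1 = (\<lambda>U. (nsets U 2, {1..<q})) ` nsets V m"
  define I2 where "I2 = (\<lambda>S. (S, {0::nat})) ` (\<Union>W\<in>nsets V r. nsets (nsets W 2) s)"
  have finV: "finite (nsets V k)" for k
    using \<open>finite V\<close> by (simp add: finite_imp_finite_nsets)
  have W: "finite W \<and> card W = k" if "W \<in> nsets V k" for W k
    using that by (auto simp: nsets_def)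
  have finW: "finite (nsets W k)" if "W \<in> nsets V r" for W k
    using W[OF that] by (simp add: finite_imp_finite_nsets)
  have fin: "finite I1" "finite I2"
    unfolding I1_def I2_def using finV W
    by (auto intro!: finite_imageI finite_imp_finite_nsets)
  let ?w = "\<lambda>(A :: 'a set set, B). (real (card B) / real q) ^ card A"
  have "sum ?w I1 \<le> (\<Sum>U\<in>nsets V m. (1 - 1 / real q) ^ (m choose 2))"
    unfolding I1_def using finV W \<open>q > 0\<close>
    by (intro order.trans[OF sum_image_le] sum_mono)
       (auto simp: card_nsets of_nat_diff diff_divide_distrib)
  also have "\<dots> \<le> real (card V) ^ m * (1 - 1 / real q) ^ (m choose 2)"
    using card_nsets_le_power[OF \<open>finite V\<close>, of m] \<open>q > 0\<close>
    by (auto intro!: mult_right_mono simp flip: of_nat_power)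
  finally have 1: "sum ?w I1 < 1 / 2" using dense by simp
  have "card (\<Union>W\<in>nsets V r. nsets (nsets W 2) s) \<le> (\<Sum>W\<in>nsets V r. card (nsets (nsets W 2) s))"
    by (rule card_UN_le[OF finV])
  also have "\<dots> \<le> (\<Sum>W\<in>nsets V r. 2 ^ (r choose 2))"
  proof (rule sum_mono)
    fix U assume U: "U \<in> nsets V r"
    \<comment> \<open>The number of \<open>s\<close>-subsets is bounded crudely by the number of all
      subsets.\<close>
    have "card (nsets (nsets U 2) s) \<le> card (Pow (nsets U 2))"
      using finW[OF U] by (intro card_mono) (auto simp: nsets_def)
    also have "\<dots> = 2 ^ (r choose 2)"
      using finW[OF U] W[OF U] by (simp add: card_Pow card_nsets)
    finally show "card (nsets (nsets U 2) s) \<le> 2 ^ (r choose 2)" .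
  qed
  also have "\<dots> \<le> card V ^ r * 2 ^ (r choose 2)"
    using card_nsets_le_power[OF \<open>finite V\<close>, of r] by simp
  finally have c: "card (\<Union>W\<in>nsets V r. nsets (nsets W 2) s) \<le> card V ^ r * 2 ^ (r choose 2)" .
  have "sum ?w I2 \<le> (\<Sum>S\<in>(\<Union>W\<in>nsets V r. nsets (nsets W 2) s). (1 / real q) ^ s)"
    unfolding I2_def using finV finW
    by (intro order.trans[OF sum_image_le] sum_mono)
       (auto simp: nsets_def[of "nsets _ _"] intro!: finite_imp_finite_nsets)
  also have "\<dots> \<le> real (card V ^ r * 2 ^ (r choose 2)) * (1 / real q) ^ s"
    using c by (simp only: sum_constant) (intro mult_right_mono, simp_all only: of_nat_le_iff, simp)
  finally have 2: "sum ?w I2 < 1 / 2" using sparse by simp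
  have w0: "0 \<le> ?w i" for i by (auto simp: case_prod_beta)
  have "sum ?w (I1 \<union> I2) \<le> sum ?w I1 + sum ?w I2"
    using fin by (simp add: sum_Un) (intro sum_nonneg, use w0 in auto)
  then have "(\<Sum>i\<in>I1 \<union> I2. (real (card (snd i)) / real q) ^ card (fst i)) < 1"
    using 1 2 by (simp add: case_prod_beta)
  then obtain f where f: "f \<in> nsets V 2 \<rightarrow> {..<q}"
    "\<And>i. i \<in> I1 \<union> I2 \<Longrightarrow> \<exists>a\<in>fst i. f a \<notin> snd i"
  proof (rule exists_function_avoiding[of "nsets V 2" "I1 \<union> I2" q fst snd, rotated -2])
    show "fst i \<subseteq> nsets V 2" if "i \<in> I1 \<union> I2" for i
      using that by (fastforce simp: I1_def I2_def nsets_def)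
    show "snd i \<subseteq> {..<q}" if "i \<in> I1 \<union> I2" for i
      using that \<open>q > 0\<close> by (auto simp: I1_def I2_def)
  qed (use finV fin \<open>q > 0\<close> in auto)
  define G where "G = {P. f P = 0}"
  show thesis
  proof (rule that[of G])
    fix U assume U: "U \<in> nsets V m"
    then have "(nsets U 2, {1..<q}) \<in> I1 \<union> I2" by (auto simp: I1_def)
    from f(2)[OF this] obtain P where P: "P \<in> nsets U 2" "f P \<notin> {1..<q}" by auto
    moreover have "f P < q" using f(1) P U by (auto simp: nsets_def Pi_iff)
    ultimately have "f P = 0" by auto
    with P(1) show "\<exists>P\<in>nsets U 2. P \<in> G" by (auto simp: G_def)
  next
    fix U assume U: "U \<in> nsets V r"
    show "card (nsets U 2 \<inter> G) < s"
    proof (rule ccontr)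
      assume "\<not> ?thesis"
      then obtain S where S: "S \<subseteq> nsets U 2 \<inter> G" "card S = s" "finite S"
        by (metis not_less obtain_subset_with_card_n)
      then have "(S, {0}) \<in> I1 \<union> I2"
        using U by (auto simp: I2_def nsets_def[of "nsets _ _"])
      from f(2)[OF this] S(1) show False by (auto simp: G_def)
    qed
  qed
qed

section \<open>Pair extensions and the colouring of triples\<close>

text \<open>Sorting recovers an increasing triple from its underlying set. This makes the counting
  of triples across ordered classes injective.\<close>

lemma strict_sorted_triple_eq:
  fixes x y z :: "'a::linorder"
  assumes "{x, y, z} = {x', y', z'}" "x < y" "y < z" "x' < y'" "y' < z'"
  shows "x = x' \<and> y = y' \<and> z = z'"
proof -
  have *: "sorted_list_of_set {a, b, c} = [a, b, c]" if "a < b" "b < c" for a b c :: 'a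
  proof -
    have "sorted_list_of_set (set [a, b, c]) = [a, b, c]"
      using that by (intro sorted_list_of_set.idem_if_sorted_distinct) auto
    then show ?thesis by (simp only: list.set)
  qed
  show ?thesis using *[of x y z] *[of x' y' z'] assms by simp
qed

text \<open>In the next definition \<open>b > 0\<close>, so \<open>a + m * b\<close> lies to the right of all base vertices
  \<open>{..<m}\<close>, and it determines \<open>a\<close> and \<open>b\<close> as its remainder and quotient modulo \<open>m\<close>.\<close>

definition pair_extension :: "nat \<Rightarrow> nat hypergraph" where
  "pair_extension m = Hypergraph {..<m * m} {{a, b, a + m * b} | a b. a < b \<and> b < m}"

lemma pair_extension_less:
  fixes a b m :: nat
  assumes "a < b" "b < m"
  shows "b < a + m * b" "a + m * b < m * m"
proof -
  have "m * 1 \<le> m * b" using assms by (intro mult_le_mono2) simp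
  then show "b < a + m * b" using assms by linarith
  have "m * Suc b \<le> m * m" using assms by (intro mult_le_mono2) simp
  then show "a + m * b < m * m" using assms by simp
qed

lemma ordered_kgraph_pair_extension: "ordered_kgraph 3 (pair_extension m)"
proof -
  have "{a, b, a + m * b} \<in> nsets {..<m * m} 3" if "a < b" "b < m" for a b
    using that pair_extension_less[OF that] by (auto simp: nsets_def)
  then show ?thesis by (auto simp: ordered_kgraph_def pair_extension_def)
qed

text \<open>The natural order is a degeneracy order: an edge counted at \<open>i\<close> has
  \<open>i\<close> as its maximum, so \<open>i = a + m * b\<close>, and division by \<open>m\<close>
  recovers the other two vertices.\<close>

lemma degenerate_pair_extension: "degenerate 1 (pair_extension m)"
proof -
  have "card {e \<in> edges (pair_extension m). i \<in> e \<and> e - {i} \<subseteq> {..<i}} \<le> 1" for i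
  proof -
    have "e = {i mod m, i div m, i}"
      if e: "e \<in> edges (pair_extension m)" "i \<in> e" "e - {i} \<subseteq> {..<i}" for e
    proof -
      obtain a b where ab: "e = {a, b, a + m * b}" "a < b" "b < m"
        using e(1) by (auto simp: pair_extension_def)
      have "i = a + m * b"
        using e(2,3) ab pair_extension_less[OF ab(2,3)] by force
      then show ?thesis using ab by simp
    qed
    then have "{e \<in> edges (pair_extension m). i \<in> e \<and> e - {i} \<subseteq> {..<i}} \<subseteq> {{i mod m, i div m, i}}"
      by blast
    from card_mono[OF _ this] show ?thesis by simp
  qed
  moreover have "set (take i [0..<m * m]) = {..<i}" if "i < m * m" for i
    using that by (auto simp: take_upt)
  ultimately show ?thesis
    unfolding degenerate_def
    by (intro exI[of _ "[0..<m * m]"]) (auto simp: pair_extension_def lessThan_atLeast0)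
qed

text \<open>Edges of \<open>G\<close> force red and thereby block every blue pair extension, with no
  randomness left. The remaining triples are coloured by coin flips; \<open>M ^ (3 * n)\<close>
  bounds the choices of three classes, and each choice leaves at least \<open>n * (n^2 - s)\<close>
  triples to chance.\<close>

lemma not_ordered_arrows_pair_extension:
  fixes M n m s :: nat and G :: "nat set set"
  assumes hit: "\<And>U. U \<in> nsets {1..M} m \<Longrightarrow> \<exists>P\<in>nsets U 2. P \<in> G"
    and sparse: "\<And>W. W \<in> nsets {1..M} (2 * n) \<Longrightarrow> card (nsets W 2 \<inter> G) < s"
    and few: "real M ^ (3 * n) * (1 / 2) ^ (n * (n\<^sup>2 - s)) < 1"
  shows "\<not> ordered_arrows 3 M (pair_extension m) (complete_tripartite3 n)"
proof -
  define D where "D X Y = {(x, y). x \<in> X \<and> y \<in> Y \<and> {x, y} \<notin> G}" for X Y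
  \<comment> \<open>The triples of a potential red copy that are not already red because of
    \<open>G\<close>.\<close>
  define T where "T = (\<lambda>(X, Y, Z). (\<lambda>((x, y), z). {x, y, z :: nat}) ` (D X Y \<times> Z))"
  define I where "I = {(X, Y, Z). X \<in> nsets {1..M} n \<and> Y \<in> nsets {1..M} n \<and> Z \<in> nsets {1..M} n \<and>
    (\<forall>x\<in>X. \<forall>y\<in>Y. x < y) \<and> (\<forall>y\<in>Y. \<forall>z\<in>Z. y < z)}"
  have sub: "I \<subseteq> nsets {1..M} n \<times> nsets {1..M} n \<times> nsets {1..M} n"
    by (auto simp: I_def)
  have fin: "finite (nsets {1..M} k)" for k by (simp add: finite_imp_finite_nsets)
  have finI: "finite I" using sub fin by (meson finite_SigmaI finite_subset)
  have "card I \<le> card (nsets {1..M} n \<times> nsets {1..M} n \<times> nsets {1..M} n)"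
    using sub fin by (intro card_mono) auto
  also have "\<dots> \<le> M ^ n * (M ^ n * M ^ n)"
    using card_nsets_le_power[of "{1..M}" n]
    by (simp only: card_cartesian_product) (intro mult_le_mono, auto)
  also have "\<dots> = M ^ (3 * n)" by (simp add: numeral_3_eq_3 power_add)
  finally have cardI: "card I \<le> M ^ (3 * n)" .
  have TE: "T i \<subseteq> nsets {1..M} 3" if "i \<in> I" for i
  proof
    fix e assume "e \<in> T i"
    obtain X Y Z where i: "i = (X, Y, Z)" by (cases i)
    with \<open>e \<in> T i\<close> obtain x y z where e: "e = {x, y, z}" "x \<in> X" "y \<in> Y" "z \<in> Z"
      by (auto simp: T_def D_def)
    have "X \<subseteq> {1..M}" "Y \<subseteq> {1..M}" "Z \<subseteq> {1..M}"
      using that by (auto simp: I_def i nsets_def)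
    moreover have "x < y" "y < z" using that e(2-4) by (auto simp: I_def i)
    ultimately show "e \<in> nsets {1..M} 3" using e by (auto simp: nsets_def)
  qed
  have cardT: "n * (n\<^sup>2 - s) \<le> card (T (X, Y, Z))" if "(X, Y, Z) \<in> I" for X Y Z
  proof -
    have X: "X \<subseteq> {1..M}" "finite X" "card X = n" and Y: "Y \<subseteq> {1..M}" "finite Y" "card Y = n"
      and Z: "finite Z" "card Z = n"
      and less: "\<And>x y. x \<in> X \<Longrightarrow> y \<in> Y \<Longrightarrow> x < y" "\<And>y z. y \<in> Y \<Longrightarrow> z \<in> Z \<Longrightarrow> y < z"
      using that by (auto simp: I_def nsets_def)
    \<comment> \<open>The edges of \<open>G\<close> between \<open>X\<close> and \<open>Y\<close>
      all lie inside \<open>X \<union> Y\<close>, a set of size \<open>2 * n\<close>, so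
      \<open>sparse\<close> limits their number.\<close>
    let ?E = "{(x, y). x \<in> X \<and> y \<in> Y \<and> {x, y} \<in> G}"
    have "X \<inter> Y = {}" using less(1) by fastforce
    then have W: "X \<union> Y \<in> nsets {1..M} (2 * n)"
      using X Y by (auto simp: nsets_def card_Un_disjoint)
    have "inj_on (\<lambda>(x, y). {x, y}) ?E"
      using less(1) by (fastforce simp: inj_on_def doubleton_eq_iff)
    then have "card ?E = card ((\<lambda>(x, y). {x, y}) ` ?E)" by (simp add: card_image)
    also have "\<dots> \<le> card (nsets (X \<union> Y) 2 \<inter> G)"
    proof (rule card_mono)
      show "finite (nsets (X \<union> Y) 2 \<inter> G)"
        using X Y by (simp add: finite_imp_finite_nsets)
      show "(\<lambda>(x, y). {x, y}) ` ?E \<subseteq> nsets (X \<union> Y) 2 \<inter> G"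
        using less(1) by (force simp: nsets_def card_2_iff)
    qed
    also have "\<dots> < s" by (rule sparse[OF W])
    finally have E: "card ?E < s" .
    have "X \<times> Y = D X Y \<union> ?E" by (auto simp: D_def)
    then have "card (X \<times> Y) \<le> card (D X Y) + card ?E"
      using card_Un_le[of "D X Y" ?E] by (simp only:)
    moreover have "card (X \<times> Y) = n\<^sup>2"
      using X Y by (simp add: card_cartesian_product power2_eq_square)
    ultimately have cardD: "n\<^sup>2 - s \<le> card (D X Y)" using E by linarith
    have "inj_on (\<lambda>((x, y), z). {x, y, z}) (D X Y \<times> Z)"
    proof (rule inj_onI)
      fix p p' assume p: "p \<in> D X Y \<times> Z" "p' \<in> D X Y \<times> Z"
        and eq: "(\<lambda>((x, y), z). {x, y, z}) p = (\<lambda>((x, y), z). {x, y, z}) p'"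
      obtain x y z x' y' z' where [simp]: "p = ((x, y), z)" "p' = ((x', y'), z')"
        by (metis surj_pair)
      show "p = p'"
        using strict_sorted_triple_eq[of x y z x' y' z'] eq p less by (auto simp: D_def)
    qed
    then have "card (T (X, Y, Z)) = card (D X Y) * n"
      using Z by (simp add: T_def card_image card_cartesian_product)
    then show ?thesis using cardD by simp
  qed
  have "(\<Sum>i\<in>I. (real (card {0::nat}) / real 2) ^ card (T i)) \<le> (\<Sum>i\<in>I. (1 / 2) ^ (n * (n\<^sup>2 - s)))"
    using cardT by (intro sum_mono) (auto intro!: power_decreasing)
  also have "\<dots> \<le> real (M ^ (3 * n)) * (1 / 2) ^ (n * (n\<^sup>2 - s))"
    using cardI by (simp only: sum_constant) (intro mult_right_mono, simp_all only: of_nat_le_iff, simp)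
  also have "\<dots> < 1" using few by simp
  finally have sum: "(\<Sum>i\<in>I. (real (card {0::nat}) / real 2) ^ card (T i)) < 1" .
  obtain f where f: "\<And>i. i \<in> I \<Longrightarrow> \<exists>e\<in>T i. f e \<notin> {0::nat}"
    by (rule exists_function_avoiding[OF fin finI _ TE _ sum]) auto
  \<comment> \<open>\<open>e - {Max e}\<close> is the pair of the two smaller vertices of a triple,
    and \<open>f e = 0\<close> is the coin showing red.\<close>
  define \<chi> where "\<chi> e = (if e - {Max e} \<in> G \<or> f e = 0 then Red else Blue)" for e
  have "\<not> contains_ordered_copy (color_class 3 M \<chi> Blue) (pair_extension m)"
  proof
    assume "contains_ordered_copy (color_class 3 M \<chi> Blue) (pair_extension m)"
    then obtain \<phi> where mono: "strict_mono_on {..<m * m} \<phi>" and im: "\<phi> ` {..<m * m} \<subseteq> {1..M}"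
      and blue: "\<And>e. e \<in> edges (pair_extension m) \<Longrightarrow> \<chi> (\<phi> ` e) = Blue"
      unfolding contains_ordered_copy_def color_class_def
      by (auto simp: pair_extension_def simp del: image_insert)
    have sq: "{..<m} \<subseteq> {..<m * m}" by (cases m) auto
    have inj: "inj_on \<phi> {..<m}"
      using strict_mono_on_imp_inj_on[OF mono] sq by (rule inj_on_subset)
    have "\<phi> ` {..<m} \<in> nsets {1..M} m"
      using order.trans[OF image_mono[OF sq] im] inj by (simp add: nsets_def card_image)
    \<comment> \<open>The base vertices of a blue copy must span an edge \<open>P\<close> of
      \<open>G\<close>. The hyperedge extending this pair has its third vertex further right, so
      \<open>P\<close> consists of its two smallest vertices and it is red.\<close>
    from hit[OF this] obtain P where P: "P \<in> nsets (\<phi> ` {..<m}) 2" "P \<in> G" by blast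
    then obtain a b where ab: "P = {\<phi> a, \<phi> b}" "a < b" "b < m"
      by (auto simp: nsets_def card_2_iff) (metis insert_commute linorder_neqE_nat)
    let ?c = "a + m * b"
    note less = pair_extension_less[OF ab(2,3)]
    have "\<phi> a < \<phi> b" "\<phi> b < \<phi> ?c"
      using mono less ab(2) by (auto simp: strict_mono_on_def)
    then have "Max (\<phi> ` {a, b, ?c}) = \<phi> ?c" "\<phi> ` {a, b, ?c} - {\<phi> ?c} = P"
      using ab(1) by (auto simp: max_def)
    then have "\<chi> (\<phi> ` {a, b, ?c}) = Red" using P(2) by (simp only: \<chi>_def) simp
    moreover have "{a, b, ?c} \<in> edges (pair_extension m)"
      unfolding pair_extension_def hypergraph.sel using ab(2,3) by blast
    ultimately show False using blue by fastforce
  qed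
  moreover have "\<not> contains_ordered_copy (color_class 3 M \<chi> Red) (complete_tripartite3 n)"
  proof
    assume "contains_ordered_copy (color_class 3 M \<chi> Red) (complete_tripartite3 n)"
    then obtain \<phi> where mono: "strict_mono_on {1..3 * n} \<phi>" and im: "\<phi> ` {1..3 * n} \<subseteq> {1..M}"
      and red: "\<And>e. e \<in> edges (complete_tripartite3 n) \<Longrightarrow> \<chi> (\<phi> ` e) = Red"
      unfolding contains_ordered_copy_def color_class_def
      by (auto simp: complete_tripartite3_def simp del: image_insert)
    let ?X = "\<phi> ` {1..n}" and ?Y = "\<phi> ` {n + 1..2 * n}" and ?Z = "\<phi> ` {2 * n + 1..3 * n}"
    have inj: "inj_on \<phi> {1..3 * n}" by (rule strict_mono_on_imp_inj_on[OF mono])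
    have part: "\<phi> ` {i..j} \<in> nsets {1..M} n" if "1 \<le> i" "j \<le> 3 * n" "j + 1 - i = n" for i j
    proof -
      have "{i..j} \<subseteq> {1..3 * n}" using that by auto
      from inj_on_subset[OF inj this] order.trans[OF image_mono[OF this] im] that(3)
      show ?thesis by (simp add: nsets_def card_image)
    qed
    \<comment> \<open>An increasing map keeps the three classes in left-to-right order, so the
      random colouring was chosen against this triple of sets.\<close>
    have "(?X, ?Y, ?Z) \<in> I"
      unfolding I_def using part mono by (auto simp: strict_mono_on_def)
    from f[OF this] obtain e where e: "e \<in> T (?X, ?Y, ?Z)" "f e \<noteq> 0" by auto
    then obtain x y z where xyz: "x \<in> {1..n}" "y \<in> {n + 1..2 * n}" "z \<in> {2 * n + 1..3 * n}"
      "e = {\<phi> x, \<phi> y, \<phi> z}" "{\<phi> x, \<phi> y} \<notin> G"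
      by (auto simp: T_def D_def)
    have "\<phi> x < \<phi> y" "\<phi> y < \<phi> z"
      using mono xyz by (auto simp: strict_mono_on_def)
    then have "Max e = \<phi> z" "e - {\<phi> z} = {\<phi> x, \<phi> y}"
      using xyz(4) by (auto simp: max_def)
    then have "\<chi> e = Blue" using xyz e(2) by (simp add: \<chi>_def)
    moreover have "{x, y, z} \<in> edges (complete_tripartite3 n)"
      unfolding complete_tripartite3_def hypergraph.sel using xyz(1-3) by blast
    from red[OF this] have "\<chi> e = Red" using xyz(4) by simp
    ultimately show False by simp
  qed
  ultimately show ?thesis unfolding ordered_arrows_def by blast
qed

section \<open>Choice of parameters and numerical estimates\<close>

text \<open>The induction starts at 4 because the inequality fails at 3; its step amounts to
  \<open>2 * n + 1 \<le> n^2\<close>.\<close>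

lemma square_le_two_power: "n \<ge> 4 \<Longrightarrow> n\<^sup>2 \<le> (2::nat) ^ n"
proof (induction n rule: dec_induct)
  case (step n)
  have "4 * n \<le> n * n" using step(1) by (intro mult_le_mono1)
  moreover have "(Suc n)\<^sup>2 = n * n + 2 * n + 1" by (simp add: power2_eq_square)
  ultimately have "(Suc n)\<^sup>2 \<le> 2 * n\<^sup>2" using step(1) unfolding power2_eq_square by linarith
  then show ?case using step by simp
qed simp

text \<open>In base-2 exponents, the three conditions compare \<open>m * n^2 / 16\<close> with
  \<open>m * q / 4\<close>, then \<open>n^3 / 8 + 2 * n^2\<close> with about \<open>n^3 / 2\<close>,
  and finally \<open>3 * n^3 / 16\<close> with \<open>n^3 / 2\<close>. The constant 1/16 leaves room
  in all three.\<close>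

lemma not_ordered_arrows_small:
  fixes M n :: nat
  assumes n: "n \<ge> 8" and M: "real M \<le> 2 powr ((real n)\<^sup>2 / 16)"
  shows "\<not> ordered_arrows 3 M (pair_extension (4 ^ n)) (complete_tripartite3 n)"
proof -
  \<comment> \<open>Density \<open>1 / q = 2^-n\<close>; \<open>m\<close> is \<open>q^2\<close>,
    which makes the expected number of edges in an \<open>m\<close>-set exceed the entropy of
    choosing that set; \<open>s\<close> is half of the \<open>n^2\<close> pairs between two
    classes.\<close>
  define q m s :: nat where "q = 2 ^ n" and "m = 4 ^ n" and "s = n\<^sup>2 div 2"
  have Mk: "real M ^ k \<le> 2 powr (real k * (real n)\<^sup>2 / 16)" for k
  proof -
    have "real M ^ k \<le> (2 powr ((real n)\<^sup>2 / 16)) ^ k" using M by (intro power_mono) auto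
    also have "\<dots> = 2 powr (real k * (real n)\<^sup>2 / 16)" by (simp add: powr_power mult.commute)
    finally show ?thesis .
  qed
  \<comment> \<open>Rounding down in \<open>s\<close> costs at most 1/2.\<close>
  have s: "real n ^ 2 / 2 - 1 / 2 \<le> real s" "2 * s \<le> n\<^sup>2"
  proof -
    have "n\<^sup>2 \<le> 2 * s + 1" by (simp add: s_def)
    then have "real (n\<^sup>2) \<le> real (2 * s + 1)" by (simp only: of_nat_le_iff)
    then show "real n ^ 2 / 2 - 1 / 2 \<le> real s" by simp
    show "2 * s \<le> n\<^sup>2" by (simp add: s_def)
  qed
  have n3: "8 * real n ^ 2 \<le> real n ^ 3" "64 \<le> real n ^ 2"
  proof -
    show "8 * real n ^ 2 \<le> real n ^ 3"
      using n mult_right_mono[of 8 "real n" "real n ^ 2"] by (simp add: power3_eq_cube power2_eq_square)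
    show "64 \<le> real n ^ 2" using n power_mono[of 8 "real n" 2] by simp
  qed
  have half: "(1 / 2 :: real) ^ k = 2 powr - real k" for k
    by (simp add: powr_minus powr_realpow power_one_over inverse_eq_divide)
  have dense: "real M ^ m * (1 - 1 / real q) ^ (m choose 2) < 1 / 2"
  proof -
    have "real (n\<^sup>2) \<le> real (2 ^ n)"
      using square_le_two_power[of n] n by (simp only: of_nat_le_iff)
    then have q: "real n ^ 2 \<le> real q" by (simp add: q_def)
    have q0: "real q > 0" and q1: "1 / real q \<le> 1" by (simp_all add: q_def)
    have mq: "real m = real q * real q"
      by (simp add: m_def q_def flip: power_mult_distrib)
    have m2: "real m \<ge> 2"
      unfolding mq using q n3(2) mult_mono[of 2 "real q" 1 "real q"] by linarith
    have "real (m choose 2) = real m * (real m - 1) / 2"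
      using m2 by (simp add: choose_two of_nat_div of_nat_diff real_of_nat_div)
    then have K: "real (m choose 2) \<ge> real m * real m / 4"
      using m2 mult_left_mono[of "real m / 2" "real m - 1" "real m"] by linarith
    \<comment> \<open>This is \<open>1 - x \<le> exp (- x)\<close> at
      \<open>x = 1 / q\<close>.\<close>
    have "(1 - 1 / real q) ^ (m choose 2) \<le> exp (- (1 / real q)) ^ (m choose 2)"
      using q1 exp_ge_add_one_self[of "- (1 / real q)"] by (intro power_mono) auto
    also have "\<dots> = exp (- (real (m choose 2) / real q))"
      by (simp flip: exp_of_nat_mult)
    also have "\<dots> \<le> exp (- (real m * real q / 4))"
    proof -
      have "real m * real q / 4 = (real m * real m / 4) / real q"
        using q0 by (simp add: mq)
      also have "\<dots> \<le> real (m choose 2) / real q"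
        using K q0 by (intro divide_right_mono) auto
      finally show ?thesis by simp
    qed
    \<comment> \<open>As \<open>ln 2 < 1\<close>, base 2 gives a weaker bound, which combines with
      the bound on \<open>M ^ m\<close>.\<close>
    also have "\<dots> \<le> 2 powr (- (real m * real q / 4))"
      using ln_2_less_1 by (simp add: powr_def mult_left_le)
    finally have "real M ^ m * (1 - 1 / real q) ^ (m choose 2)
        \<le> 2 powr (real m * (real n)\<^sup>2 / 16) * 2 powr (- (real m * real q / 4))"
      using Mk[of m] q1 by (intro mult_mono) auto
    also have "\<dots> = 2 powr (real m * (real n ^ 2 / 16 - real q / 4))"
      by (simp add: algebra_simps flip: powr_add)
    also have "\<dots> < 2 powr - 1"
    proof -
      \<comment> \<open>With \<open>q \<ge> n^2 \<ge> 64\<close> the left side is at most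
        \<open>- 3 * n^2 / 16 \<le> - 12\<close>.\<close>
      have "real n ^ 2 / 16 - real q / 4 \<le> - 1" using q n3(2) by linarith
      then have "real m * (real n ^ 2 / 16 - real q / 4) \<le> real m * - 1"
        by (intro mult_left_mono) auto
      then show ?thesis using m2 by (intro powr_less_mono) auto
    qed
    finally show ?thesis by (simp add: powr_minus)
  qed
  have sparse: "real M ^ (2 * n) * 2 ^ ((2 * n) choose 2) * (1 / real q) ^ s < 1 / 2"
  proof -
    have ch: "(2 * n) choose 2 \<le> 2 * n\<^sup>2"
      by (simp add: choose_two power2_eq_square div_le_mono)
    have "(1 / real q) ^ s = 2 powr - (real n * real s)"
      using half[of "n * s"] by (simp add: q_def power_mult power_one_over)
    moreover have "(2::real) ^ ((2 * n) choose 2) \<le> 2 powr (2 * real n ^ 2)"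
      using power_increasing[OF ch, of "2::real"] powr_realpow[of 2 "2 * n\<^sup>2"] by simp
    ultimately have "real M ^ (2 * n) * 2 ^ ((2 * n) choose 2) * (1 / real q) ^ s
        \<le> 2 powr (real (2 * n) * (real n)\<^sup>2 / 16) * 2 powr (2 * real n ^ 2) * 2 powr - (real n * real s)"
      using Mk[of "2 * n"] by (intro mult_mono) auto
    also have "\<dots> = 2 powr (real n ^ 3 / 8 + 2 * real n ^ 2 - real n * real s)"
      by (simp add: power3_eq_cube power2_eq_square mult.assoc flip: powr_add)
    also have "\<dots> < 2 powr - 1"
    proof -
      \<comment> \<open>The choice \<open>n \<ge> 8\<close> gives
        \<open>2 * n^2 \<le> n^3 / 4\<close>, so the exponent is at most
        \<open>- n^3 / 8 + n / 2\<close>.\<close>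
      have "real n * (real n ^ 2 / 2 - 1 / 2) \<le> real n * real s"
        using s(1) by (intro mult_left_mono) auto
      then have "real n ^ 3 / 2 - real n / 2 \<le> real n * real s"
        by (simp add: algebra_simps power3_eq_cube power2_eq_square)
      moreover have "8 * real n \<le> real n ^ 2" using n by (simp add: power2_eq_square)
      ultimately show ?thesis using n3 n by (intro powr_less_mono) linarith+
    qed
    finally show ?thesis by (simp add: powr_minus)
  qed
  have few: "real M ^ (3 * n) * (1 / 2) ^ (n * (n\<^sup>2 - s)) < 1"
  proof -
    have "real M ^ (3 * n) * (1 / 2) ^ (n * (n\<^sup>2 - s))
        \<le> 2 powr (real (3 * n) * (real n)\<^sup>2 / 16) * 2 powr - real (n * (n\<^sup>2 - s))"
      using Mk[of "3 * n"] half by (intro mult_mono) auto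
    also have "\<dots> = 2 powr (3 * real n ^ 3 / 16 - real n * real (n\<^sup>2 - s))"
      by (simp add: power3_eq_cube power2_eq_square mult.assoc flip: powr_add)
    also have "\<dots> < 2 powr 0"
    proof -
      \<comment> \<open>At least half of the pairs between two classes are non-edges, so the
        exponent is at most \<open>3 * n^3 / 16 - n^3 / 2 < 0\<close>.\<close>
      have "n\<^sup>2 \<le> 2 * (n\<^sup>2 - s)" using s(2) by simp
      then have "real (n\<^sup>2) \<le> real (2 * (n\<^sup>2 - s))" by (simp only: of_nat_le_iff)
      then have "real n * (real n ^ 2 / 2) \<le> real n * real (n\<^sup>2 - s)"
        by (intro mult_left_mono) auto
      then have "real n ^ 3 / 2 \<le> real n * real (n\<^sup>2 - s)"
        by (simp add: power3_eq_cube power2_eq_square)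
      then show ?thesis using n3 by (intro powr_less_mono) linarith+
    qed
    finally show ?thesis by simp
  qed
  have "q > 0" by (simp add: q_def)
  obtain G where "\<And>U. U \<in> nsets {1..M} m \<Longrightarrow> \<exists>P\<in>nsets U 2. P \<in> G"
    and "\<And>W. W \<in> nsets {1..M} (2 * n) \<Longrightarrow> card (nsets W 2 \<inter> G) < s"
    using sparse_graph_hitting_large_sets[of "{1..M}" q m "2 * n" s] dense sparse \<open>q > 0\<close> by auto
  then show ?thesis
    using not_ordered_arrows_pair_extension[OF _ _ few] unfolding m_def by blast
qed

section \<open>The lower bound for the ordered Ramsey number\<close>

lemma ordered_kgraph_complete_tripartite3: "ordered_kgraph 3 (complete_tripartite3 n)"
  by (auto simp: ordered_kgraph_def complete_tripartite3_def nsets_def)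

theorem theorem1p7:
  shows "\<exists>c C :: real. c > 0 \<and> C > 0 \<and>
    (\<exists>n0. \<forall>n::nat. n \<ge> n0 \<longrightarrow>
      (\<exists>F :: nat hypergraph.
         ordered_kgraph 3 F \<and> degenerate 1 F \<and>
         real (card (verts F)) \<le> 2 powr (C * real n) \<and>
         real (ordered_ramsey 3 F (complete_tripartite3 n)) > 2 powr (c * (real n)\<^sup>2)))"
\<comment> \<open>\<open>1 / 16\<close> is the exponent constant of
  \<open>not_ordered_arrows_small\<close>, and 4 comes from the \<open>4^n * 4^n = 2^(4 * n)\<close>
  vertices of the pair extension.\<close>
proof (rule exI[of _ "1 / 16"], rule exI[of _ 4], intro conjI exI[of _ "8 :: nat"] allI impI)
  fix n :: nat assume n: "n \<ge> 8"
  let ?F = "pair_extension (4 ^ n)" and ?K = "complete_tripartite3 n"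
  have "real (card (verts ?F)) = 16 ^ n"
    by (simp add: pair_extension_def flip: power_mult_distrib)
  also have "\<dots> = 2 powr (4 * real n)"
    using powr_realpow[of 2 "4 * n"] by (simp add: power_mult)
  finally have "real (card (verts ?F)) \<le> 2 powr (4 * real n)" by simp
  \<comment> \<open>By Ramsey's theorem the minimum is attained, so the Ramsey number itself arrows.
    Taking it as \<open>M\<close> in \<open>not_ordered_arrows_small\<close> shows that it exceeds
    the bound there.\<close>
  moreover have "ordered_arrows 3 (ordered_ramsey 3 ?F ?K) ?F ?K"
    unfolding ordered_ramsey_def
    using ordered_arrows_exists[OF ordered_kgraph_pair_extension ordered_kgraph_complete_tripartite3]
    by (rule LeastI_ex)
  then have "real (ordered_ramsey 3 ?F ?K) > 2 powr (1 / 16 * (real n)\<^sup>2)"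
    using not_ordered_arrows_small[OF n, of "ordered_ramsey 3 ?F ?K"] by force
  ultimately show "\<exists>F :: nat hypergraph. ordered_kgraph 3 F \<and> degenerate 1 F \<and>
      real (card (verts F)) \<le> 2 powr (4 * real n) \<and>
      real (ordered_ramsey 3 F ?K) > 2 powr (1 / 16 * (real n)\<^sup>2)"
    using ordered_kgraph_pair_extension degenerate_pair_extension by blast
qed auto

end
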